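(* Suppose $S=\Bbbk[[H]]$ is a far-flung Gorenstein complete numerical semigroup ring. Then $s(S)\geq 2$.
   Context: $\Bbbk$ is an algebraically closed field of characteristic $0$. A numerical semigroup is a submonoid $H$ of $\mathbb N=\{0,1,2,\dots\}$ with finite complement; here $H\neq\mathbb N$ (rings in the paper are non-regular) is minimally generated by $b_1<\dots<b_m$, and $S=\Bbbk[[H]]=\Bbbk[[t^{b_1},\dots,t^{b_m}]]\subseteq\overline S=\Bbbk[[t]]$. The conductor of $S$ is $\mathfrak C=S:_{\operatorname{Frac}(S)}\overline S$. The reduced type is $s(S)=\dim_\Bbbk\frac{\mathfrak C+t^{b_1}S}{t^{b_1}S}$. $S$ is far-flung Gorenstein if the trace ideal of its canonical module $\omega_S$, namely $\sum_{f\in\operatorname{Hom}_S(\omega_S,S)}f(\omega_S)$, equals $\mathfrak C$. (Such rings, being non-regular, are non-Gorenstein.) *)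

theory Defs
  imports
    "HOL-Library.FuncSet"
    "HOL-Library.Extended_Nat"
    "HOL-Computational_Algebra.Formal_Laurent_Series"
    "HOL-Algebra.Module"
    "HOL-Algebra.Ideal"
begin

section \<open>Modules over a commutative ring\<close>

definition module_hom ::
  "('a, 'r) ring_scheme \<Rightarrow> ('a, 'b, 'p) module_scheme \<Rightarrow> ('a, 'c, 'q) module_scheme \<Rightarrow> ('b \<Rightarrow> 'c) set"
  where
  "module_hom R M N =
     {f \<in> carrier M \<rightarrow> carrier N.
        (\<forall>x\<in>carrier M. \<forall>y\<in>carrier M. f (x \<oplus>\<^bsub>M\<^esub> y) = f x \<oplus>\<^bsub>N\<^esub> f y) \<and>
        (\<forall>r\<in>carrier R. \<forall>x\<in>carrier M. f (r \<odot>\<^bsub>M\<^esub> x) = r \<odot>\<^bsub>N\<^esub> f x)}"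

definition module_ker :: "('a, 'b, 'p) module_scheme \<Rightarrow> ('a, 'c, 'q) module_scheme \<Rightarrow> ('b \<Rightarrow> 'c) \<Rightarrow> 'b set"
  where "module_ker M N f = {x \<in> carrier M. f x = \<zero>\<^bsub>N\<^esub>}"

definition finitely_generated_module :: "('a, 'r) ring_scheme \<Rightarrow> ('a, 'b, 'p) module_scheme \<Rightarrow> bool"
  where
  "finitely_generated_module R M \<longleftrightarrow>
     (\<exists>B \<subseteq> carrier M. finite B \<and> (\<forall>N. submodule N R M \<and> B \<subseteq> N \<longrightarrow> N = carrier M))"

definition module_of_ideal :: "('a, 'r) ring_scheme \<Rightarrow> 'a set \<Rightarrow> ('a, 'a) module"
  where
  "module_of_ideal R J =
     \<lparr>carrier = J, monoid.mult = monoid.mult R, one = one R, zero = zero R, add = add R, module.smult = monoid.mult R\<rparr>"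

text \<open>Injectivity in Baer's form: homomorphisms defined on an ideal extend to the whole ring.
  The general lifting property would quantify over modules of all types.\<close>

definition injective_module :: "('a, 'r) ring_scheme \<Rightarrow> ('a, 'b, 'p) module_scheme \<Rightarrow> bool"
  where
  "injective_module R I \<longleftrightarrow> module R I \<and>
     (\<forall>J. ideal J R \<longrightarrow>
        (\<forall>f \<in> module_hom R (module_of_ideal R J) I.
           \<exists>g \<in> module_hom R (module_of_ideal R (carrier R)) I. \<forall>r\<in>J. g r = f r))"

text \<open>An injective resolution
  \<open>0 \<rightarrow> M \<rightarrow> I 0 \<rightarrow> I 1 \<rightarrow> \<dots>\<close> with \<open>I j = 0\<close> for all large \<open>j\<close>. The type
  argument is the type in which the modules of the resolution live.\<close>

definition finite_injective_dimension ::
  "'i itself \<Rightarrow> ('a, 'r) ring_scheme \<Rightarrow> ('a, 'b, 'p) module_scheme \<Rightarrow> bool"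
  where
  "finite_injective_dimension (_ :: 'i itself) R M \<longleftrightarrow>
     (\<exists>(I :: nat \<Rightarrow> ('a, 'i) module) e d.
        (\<forall>j. injective_module R (I j)) \<and>
        e \<in> module_hom R M (I 0) \<and> inj_on e (carrier M) \<and>
        (\<forall>j. d j \<in> module_hom R (I j) (I (Suc j))) \<and>
        e ` carrier M = module_ker (I 0) (I 1) (d 0) \<and>
        (\<forall>j. d j ` carrier (I j) = module_ker (I (Suc j)) (I (Suc (Suc j))) (d (Suc j))) \<and>
        (\<exists>n. \<forall>j>n. carrier (I j) = {\<zero>\<^bsub>I j\<^esub>}))"

section \<open>Numerical semigroups and their complete semigroup rings\<close>

definition numerical_semigroup :: "nat set \<Rightarrow> bool"
  where
  "numerical_semigroup H \<longleftrightarrow> 0 \<in> H \<and> (\<forall>a\<in>H. \<forall>b\<in>H. a + b \<in> H) \<and> finite (- H)"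

text \<open>The minimal generating set of \<open>H\<close> is unique: it consists of the nonzero elements that
  are not a sum of two nonzero elements.\<close>

definition minimal_generators :: "nat set \<Rightarrow> nat set"
  where
  "minimal_generators H = {h \<in> H - {0}. \<not> (\<exists>a \<in> H - {0}. \<exists>b \<in> H - {0}. h = a + b)}"

definition least_generator :: "nat set \<Rightarrow> nat"
  where "least_generator H = (LEAST b. b \<in> minimal_generators H)"

text \<open>Everything takes place inside \<open>k((t))\<close>, which is the fraction field of \<open>k[[H]]\<close> as well
  as of \<open>k[[t]]\<close>, because \<open>H\<close> has finite complement.\<close>

definition semigroup_ring_set :: "nat set \<Rightarrow> 'k::field fls set"
  where "semigroup_ring_set H = fps_to_fls ` {f. \<forall>n. fps_nth f n \<noteq> 0 \<longrightarrow> n \<in> H}"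

definition semigroup_ring :: "nat set \<Rightarrow> 'k::field fls ring"
  where
  "semigroup_ring H =
     \<lparr>carrier = semigroup_ring_set H, monoid.mult = (*), one = 1, zero = 0, add = (+)\<rparr>"

definition maximal_ideal :: "nat set \<Rightarrow> 'k::field fls set"
  where "maximal_ideal H = {f \<in> semigroup_ring_set H. fls_nth f 0 = 0}"

definition conductor :: "nat set \<Rightarrow> 'k::field fls set"
  where "conductor H = {f. \<forall>g \<in> range fps_to_fls. f * g \<in> semigroup_ring_set H}"

text \<open>A subset of \<open>k((t))\<close> with the operations of \<open>k((t))\<close>; the fields \<open>mult\<close> and \<open>one\<close>
  are forced by the record type and play no role.\<close>

definition laurent_module :: "'k::field fls set \<Rightarrow> ('k fls, 'k fls) module"
  where
  "laurent_module W =
     \<lparr>carrier = W, monoid.mult = (*), one = 1, zero = 0, add = (+), module.smult = (*)\<rparr>"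

text \<open>\<open>dim\<^sub>k (V / W)\<close> for \<open>k\<close>-subspaces \<open>W \<subseteq> V\<close> of \<open>k((t))\<close>: the least size of a finite
  subset of \<open>V\<close> whose image spans \<open>V / W\<close>, and \<open>\<infinity>\<close> if there is none.\<close>

definition quotient_dim :: "'k::field fls set \<Rightarrow> 'k fls set \<Rightarrow> enat"
  where
  "quotient_dim V W =
     (INF B \<in> {B. finite B \<and> B \<subseteq> V \<and>
                  V \<subseteq> Modules.module.span (\<lambda>c f. fls_const c * f) (B \<union> W)}. enat (card B))"

definition reduced_type :: "'k::field itself \<Rightarrow> nat set \<Rightarrow> enat"
  where
  "reduced_type (_ :: 'k itself) H =
     (let xS = (\<lambda>f. fls_X ^ least_generator H * f) ` (semigroup_ring_set H :: 'k fls set)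
      in quotient_dim {c + f | c f. c \<in> conductor H \<and> f \<in> xS} xS)"

section \<open>Canonical module and trace ideal\<close>

text \<open>For a fractional ideal \<open>W\<close> and \<open>x\<close> the power of \<open>t\<close> given by the least generator,
  which is \<open>W\<close>-regular, the type of \<open>W\<close> is the dimension of
  \<open>Ext\<^sup>1(k, W) \<cong> Hom(k, W / xW)\<close>, that is, of the socle of \<open>W / xW\<close>.\<close>

definition cm_type :: "nat set \<Rightarrow> 'k::field fls set \<Rightarrow> enat"
  where
  "cm_type H W =
     (let xW = (\<lambda>w. fls_X ^ least_generator H * w) ` W
      in quotient_dim {w \<in> W. \<forall>r \<in> maximal_ideal H. r * w \<in> xW} xW)"

text \<open>A canonical module is a maximal Cohen-Macaulay module of type 1 and of finite injective
  dimension. As \<open>k[[H]]\<close> is a one-dimensional domain, it may be taken to be a fractional ideal,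
  and a nonzero finitely generated module is maximal Cohen-Macaulay if and only if some element
  of the maximal ideal is regular on it. If \<open>W\<close> is canonical, then
  \<open>0 \<rightarrow> W \<rightarrow> k((t)) \<rightarrow> k((t)) / W \<rightarrow> 0\<close> is an injective resolution, whose terms are
  (isomorphic to) modules of cosets; so the type \<open>'k fls set\<close> is large enough.\<close>

definition canonical_module :: "nat set \<Rightarrow> 'k::field fls set \<Rightarrow> bool"
  where
  "canonical_module H W \<longleftrightarrow>
     module (semigroup_ring H) (laurent_module W) \<and>
     finitely_generated_module (semigroup_ring H) (laurent_module W) \<and>
     W \<noteq> {0} \<and>
     (\<exists>x \<in> maximal_ideal H. \<forall>w\<in>W. x * w = 0 \<longrightarrow> w = 0) \<and>
     cm_type H W = 1 \<and>
     finite_injective_dimension TYPE('k fls set) (semigroup_ring H) (laurent_module W)"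

text \<open>The sum of the ideals \<open>f(W)\<close>, as the ideal generated by their union.\<close>

definition trace_ideal :: "nat set \<Rightarrow> 'k::field fls set \<Rightarrow> 'k fls set"
  where
  "trace_ideal H W =
     Idl\<^bsub>semigroup_ring H\<^esub>
       (\<Union>f \<in> module_hom (semigroup_ring H) (laurent_module W) (laurent_module (semigroup_ring_set H)).
          f ` W)"

text \<open>Canonical modules are unique up to isomorphism and isomorphic modules have the same trace
  ideal, so the choice of \<open>W\<close> does not matter.\<close>

definition far_flung_Gorenstein :: "'k::field itself \<Rightarrow> nat set \<Rightarrow> bool"
  where
  "far_flung_Gorenstein (_ :: 'k itself) H \<longleftrightarrow>
     (\<exists>W :: 'k fls set. canonical_module H W \<and> trace_ideal H W = conductor H)"

end

theory Submission
  imports Defs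
begin

text \<open>
  Let \<open>F\<close> be the Frobenius number of \<open>H\<close>. If \<open>F - 1\<close> is a gap as well, then \<open>t\<^bsup>F+b\<^esup>\<close> and
  \<open>t\<^bsup>F+b-1\<^esup>\<close>, where \<open>b = b\<^sub>1 \<ge> 2\<close>, lie in the conductor and are linearly independent modulo
  \<open>t\<^bsup>b\<^esup> S\<close>, so the reduced type is at least two.

  Let \<open>W\<close> be canonical. Having type one, \<open>(W : \<mm>) / W\<close> is spanned by one class \<open>s\<close>. A linear
  functional on \<open>k((t))\<close> that vanishes on \<open>W\<close> but not at \<open>s\<close> vanishes on \<open>t\<^bsup>N\<^esup> k[[t]]\<close>
  for some \<open>N\<close>, so it sends \<open>f\<close> to the constant coefficient of \<open>g f\<close>, for a fixed
  Laurent series \<open>g\<close>. As \<open>(W : \<mm>) / W\<close> is the socle of \<open>k((t)) / W\<close>, this gives \<open>g W = K\<close>, the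
  series supported on the integers \<open>- l\<close> with \<open>l \<notin> H\<close>. If \<open>F - 1\<close> were in \<open>H\<close>, then \<open>t\<^bsup>2F-1\<^esup> K \<subseteq> S\<close>, so
  multiplication by \<open>t\<^bsup>2F-1\<^esup> g\<close> would send \<open>g\<^sup>-\<^sup>1 t\<^bsup>-F\<^esup> \<in> W\<close> to \<open>t\<^bsup>F-1\<^esup>\<close>, an element of the
  trace ideal outside the conductor.
\<close>

section \<open>Laurent series as a vector space\<close>

abbreviation fls_scale :: "'k::field \<Rightarrow> 'k fls \<Rightarrow> 'k fls"
  where "fls_scale \<equiv> \<lambda>c f. fls_const c * f"

lemma fls_const_add: "fls_const (a + b) = fls_const a + (fls_const b :: 'k::field fls)"
  by (rule fls_eqI) simp

interpretation fls: vector_space "fls_scale :: 'k::field \<Rightarrow> 'k fls \<Rightarrow> 'k fls"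
  by unfold_locales (auto simp: algebra_simps fls_const_add simp flip: fls_const_mult_const)

text \<open>The field is taken as a space over itself, so that linear maps of this pair are the
  functionals on Laurent series.\<close>

interpretation fls_functional: vector_space_pair
  "fls_scale :: 'k::field \<Rightarrow> 'k fls \<Rightarrow> 'k fls" "(*) :: 'k \<Rightarrow> 'k \<Rightarrow> 'k"
  by unfold_locales (auto simp: algebra_simps)

lemma quotient_dim_le:
  assumes "finite B" "B \<subseteq> V" "V \<subseteq> fls.span (B \<union> U)"
  shows "quotient_dim V U \<le> enat (card B)"
  unfolding quotient_dim_def by (rule INF_lower) (use assms in auto)

lemma quotient_dim_eq_1E:
  fixes V U :: "'k::field fls set"
  assumes "quotient_dim V U = 1" and "fls.subspace U"
  obtains b where "b \<in> V" "b \<notin> U" "\<And>v. v \<in> V \<Longrightarrow> \<exists>c. v - fls_const c * b \<in> U"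
proof -
  have span_U: "fls.span U = U"
    using assms(2) by (simp add: fls.span_eq_iff)
  have not_sub: "\<not> V \<subseteq> U"
    using quotient_dim_le[of "{}" V U] assms(1) span_U by (auto simp: zero_enat_def one_enat_def)
  have "\<exists>B. finite B \<and> B \<subseteq> V \<and> V \<subseteq> fls.span (B \<union> U) \<and> card B < 2"
  proof (rule ccontr)
    assume "\<not> ?thesis"
    then have "enat 2 \<le> quotient_dim V U"
      unfolding quotient_dim_def by (intro INF_greatest) (force simp: not_less)
    with assms(1) show False by (simp add: one_enat_def)
  qed
  then obtain B where B: "finite B" "B \<subseteq> V" "V \<subseteq> fls.span (B \<union> U)" "card B < 2"
    by blast
  have "B \<noteq> {}"
    using B(3) span_U not_sub by (metis Un_empty_left)
  with B(1,4) have "card B = 1"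
    by (metis One_nat_def card_0_eq less_2_cases)
  then obtain b where b: "B = {b}"
    by (auto simp: card_1_singleton_iff)
  have dec: "\<exists>c. v - fls_const c * b \<in> U" if "v \<in> V" for v
  proof -
    have "v \<in> fls.span (insert b U)" using B(3) that unfolding b by auto
    then show ?thesis by (simp add: fls.span_breakdown_eq span_U)
  qed
  have "b \<notin> U"
  proof
    assume "b \<in> U"
    then have "fls.span (B \<union> U) = U"
      using span_U by (simp add: b insert_absorb)
    with B(3) not_sub show False by simp
  qed
  with dec b B(2) show thesis using that by blast
qed

text \<open>The coefficients at \<open>p\<close> and \<open>q\<close> give a linear map to the plane
  that kills \<open>U\<close> and takes both unit vectors on \<open>V\<close>; a single generator
  would confine the image to a line.\<close>

lemma two_le_quotient_dimI:
  fixes V U :: "'k::field fls set"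
  assumes U: "\<And>u. u \<in> U \<Longrightarrow> fls_nth u p = 0 \<and> fls_nth u q = 0"
    and v: "v \<in> V" "fls_nth v p = 1" "fls_nth v q = 0"
    and w: "w \<in> V" "fls_nth w p = 0" "fls_nth w q = 1"
  shows "2 \<le> quotient_dim V U"
  unfolding quotient_dim_def
proof (rule INF_greatest)
  fix B assume "B \<in> {B. finite B \<and> B \<subseteq> V \<and> V \<subseteq> fls.span (B \<union> U)}"
  then have B: "finite B" "V \<subseteq> fls.span (B \<union> U)" by auto
  have "\<not> card B < 2"
  proof
    assume "card B < 2"
    then have "B = {} \<or> (\<exists>b. B = {b})"
      using B(1) by (metis One_nat_def card_0_eq card_1_singletonE less_2_cases)
    then obtain b where b: "B \<subseteq> {b}" by blast
    \<comment> \<open>The preimage of the line spanned by the coefficient pair of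
      \<open>b\<close>.\<close>
    let ?L = "{f. \<exists>c. fls_nth f p = c * fls_nth b p \<and> fls_nth f q = c * fls_nth b q}"
    have "fls.subspace ?L"
    proof (rule fls.subspaceI)
      show "0 \<in> ?L" by (auto intro: exI[of _ 0])
      show "x + y \<in> ?L" if "x \<in> ?L" "y \<in> ?L" for x y
      proof -
        from that obtain c d where
          "fls_nth x p = c * fls_nth b p \<and> fls_nth x q = c * fls_nth b q"
          "fls_nth y p = d * fls_nth b p \<and> fls_nth y q = d * fls_nth b q" by auto
        then show ?thesis by (auto intro!: exI[of _ "c + d"] simp: algebra_simps)
      qed
      show "fls_const a * x \<in> ?L" if "x \<in> ?L" for a x
      proof -
        from that obtain c where
          "fls_nth x p = c * fls_nth b p \<and> fls_nth x q = c * fls_nth b q" by auto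
        then have "fls_nth (fls_const a * x) p = (a * c) * fls_nth b p"
          "fls_nth (fls_const a * x) q = (a * c) * fls_nth b q"
          by (simp_all only: fls_mult_const_nth mult.assoc)
        then show ?thesis by blast
      qed
    qed
    moreover have "B \<union> U \<subseteq> ?L"
    proof
      fix x assume "x \<in> B \<union> U"
      then consider "x = b" | "x \<in> U" using b by blast
      then show "x \<in> ?L"
      proof cases
        case 1
        then show ?thesis by (intro CollectI exI[of _ 1]) simp
      next
        case 2
        then show ?thesis by (intro CollectI exI[of _ 0]) (simp add: U)
      qed
    qed
    ultimately have "V \<subseteq> ?L"
      using B(2) fls.span_minimal by blast
    then have "v \<in> ?L" "w \<in> ?L" using v(1) w(1) by blast+
    then obtain c d where "1 = c * fls_nth b p" "0 = c * fls_nth b q" "1 = d * fls_nth b q"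
      unfolding mem_Collect_eq v(2,3) w(2,3) by blast
    then show False by (metis mult_eq_0_iff zero_neq_one)
  qed
  then show "2 \<le> enat (card B)" by (simp add: numeral_eq_enat)
qed

section \<open>Linear functionals on Laurent series\<close>

lemma functional_separating_subspace:
  fixes W :: "'k::field fls set"
  assumes "fls.subspace W" "s \<notin> W"
  obtains \<phi> :: "'k fls \<Rightarrow> 'k" where
    "\<And>f g. \<phi> (f + g) = \<phi> f + \<phi> g" "\<And>c f. \<phi> (fls_const c * f) = c * \<phi> f"
    "\<And>w. w \<in> W \<Longrightarrow> \<phi> w = 0" "\<phi> s = 1"
proof -
  obtain B where B: "B \<subseteq> W" "fls.independent B" "W \<subseteq> fls.span B"
    using fls.maximal_independent_subset by blast
  have "fls.span B = W"
    using B assms(1) by (simp add: fls.span_subspace)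
  \<comment> \<open>Values on an independent set may be prescribed: 1 at \<open>s\<close> and 0 on a
    basis of \<open>W\<close>.\<close>
  then have "fls.independent (insert s B)"
    using B assms(2) by (intro fls.independent_insertI) auto
  then obtain \<phi> where \<phi>: "Vector_Spaces.linear fls_scale (*) \<phi>"
      "\<forall>x\<in>insert s B. \<phi> x = (if x = s then 1 else 0)"
    using fls_functional.linear_independent_extend[of "insert s B" "\<lambda>x. if x = s then 1 else 0"]
    by blast
  have "\<phi> w = 0" if "w \<in> W" for w
    using fls_functional.linear_eq_0_on_span[OF \<phi>(1), of B w] \<phi>(2) B assms(2) that
    by (metis insertCI subsetD)
  moreover have "\<phi> s = 1"
    using \<phi>(2) by simp
  ultimately show thesis
    using that fls_functional.linear_add[OF \<phi>(1)] fls_functional.linear_scale[OF \<phi>(1)] by blast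
qed

lemma fls_times_nth_eq_0:
  fixes f g :: "'k::field fls"
  assumes "\<And>i. i < a \<Longrightarrow> fls_nth f i = 0" "\<And>i. i < b \<Longrightarrow> fls_nth g i = 0" "n < a + b"
  shows "fls_nth (f * g) n = 0"
\<comment> \<open>The zero series has \<open>fls_subdegree\<close> 0 by convention, so it obeys no
  order bound.\<close>
proof (cases "f = 0 \<or> g = 0")
  case False
  then have "a \<le> fls_subdegree f" "b \<le> fls_subdegree g"
    using assms by (auto intro!: fls_subdegree_geI)
  with False assms(3) show ?thesis
    by (intro fls_eq0_below_subdegree) simp
qed auto

text \<open>Up to a tail killed by \<open>\<phi>\<close>, a series is a finite combination of powers
  of t, so the values of \<open>\<phi>\<close> on these powers determine it.\<close>

lemma continuous_functional_representation:
  fixes \<phi> :: "'k::field fls \<Rightarrow> 'k"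
  assumes add: "\<And>f g. \<phi> (f + g) = \<phi> f + \<phi> g"
    and scale: "\<And>c f. \<phi> (fls_const c * f) = c * \<phi> f"
    and cont: "\<And>f. (\<And>k. k < N \<Longrightarrow> fls_nth f k = 0) \<Longrightarrow> \<phi> f = 0"
  obtains g where "\<And>f. \<phi> f = fls_nth (g * f) 0"
proof -
  \<comment> \<open>The coefficient of \<open>g\<close> at i meets that of \<open>f\<close> at -i in
    the constant term. For i < 1 - N we have -i >= N, so \<open>\<phi>\<close> vanishes there and
    \<open>g\<close> has a lowest term.\<close>
  define g where "g = Abs_fls (\<lambda>i. \<phi> (fls_X_intpow (- i)))"
  have g_nth: "fls_nth g i = \<phi> (fls_X_intpow (- i))" for i
    unfolding g_def by (rule nth_Abs_fls_lower_bound[of "1 - N"]) (auto intro!: cont)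
  have g_low: "fls_nth g i = 0" if "i < 1 - N" for i
    unfolding g_nth by (rule cont) (use that in auto)
  have "\<phi> f = fls_nth (g * f) 0" if "\<And>k. k < N - int n \<Longrightarrow> fls_nth f k = 0" for f n
    using that
  proof (induction n arbitrary: f)
    case 0
    then have "\<phi> f = 0" by (intro cont) simp
    moreover have "fls_nth (g * f) 0 = 0"
      by (rule fls_times_nth_eq_0[where a = "1 - N" and b = N]) (use 0 g_low in auto)
    ultimately show ?case by simp
  next
    \<comment> \<open>Peel off the lowest possible term \<open>?m\<close> of \<open>f\<close>; the
      rest \<open>r\<close> starts one place higher.\<close>
    case (Suc n)
    let ?j = "N - int (Suc n)"
    let ?m = "fls_const (fls_nth f ?j) * fls_X_intpow ?j"
    define r where "r = f - ?m"
    have f: "f = r + ?m" by (simp add: r_def)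
    have "fls_nth r k = 0" if "k < N - int n" for k
      using Suc.prems[of k] that by (cases "k = ?j") (auto simp: r_def fls_X_intpow_times_conv_shift)
    then have "\<phi> r = fls_nth (g * r) 0" by (rule Suc.IH)
    moreover have "\<phi> ?m = fls_nth (g * ?m) 0"
    proof -
      have "g * ?m = fls_const (fls_nth f ?j) * (g * fls_X_intpow ?j)"
        by (rule mult.left_commute)
      moreover have "fls_nth (g * fls_X_intpow ?j) 0 = fls_nth g (- ?j)"
        unfolding fls_X_intpow_times_conv_shift(2) by simp
      ultimately show ?thesis
        unfolding scale g_nth by (simp only: fls_mult_const_nth minus_minus g_nth)
    qed
    ultimately show ?case
      by (subst (1 2) f) (simp add: add distrib_left)
  qed
  moreover have "\<exists>n. \<forall>k < N - int n. fls_nth f k = 0" for f :: "'k fls"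
    by (rule exI[of _ "nat (N - fls_subdegree f)"]) auto
  ultimately show thesis using that by metis
qed

section \<open>Numerical semigroup rings\<close>

lemma semigroup_ring_set_iff:
  "f \<in> semigroup_ring_set H \<longleftrightarrow> (\<forall>n. fls_nth f n \<noteq> 0 \<longrightarrow> n \<in> int ` H)"
proof
  assume "f \<in> semigroup_ring_set H"
  then obtain h where "f = fps_to_fls h" "\<forall>n. fps_nth h n \<noteq> 0 \<longrightarrow> n \<in> H"
    by (auto simp: semigroup_ring_set_def)
  then show "\<forall>n. fls_nth f n \<noteq> 0 \<longrightarrow> n \<in> int ` H"
    by (auto split: if_splits intro!: image_eqI[of _ int "nat _"])
next
  assume *: "\<forall>n. fls_nth f n \<noteq> 0 \<longrightarrow> n \<in> int ` H"
  have "fls_nth f n = 0" if "n < 0" for n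
    using * that by (metis imageE not_less of_nat_0_le_iff)
  then have "f = fps_to_fls (fls_regpart f)"
    by (intro fls_eqI) simp
  moreover have "\<forall>n. fps_nth (fls_regpart f) n \<noteq> 0 \<longrightarrow> n \<in> H"
    using * by auto
  ultimately show "f \<in> semigroup_ring_set H"
    unfolding semigroup_ring_set_def by blast
qed

lemma fls_X_power_in_semigroup_ring: "n \<in> H \<Longrightarrow> fls_X ^ n \<in> semigroup_ring_set H"
  by (simp add: semigroup_ring_set_iff)

lemma fls_const_in_semigroup_ring: "0 \<in> H \<Longrightarrow> fls_const c \<in> semigroup_ring_set H"
  by (auto simp: semigroup_ring_set_iff)

lemma in_conductor_if_high_order:
  fixes f :: "'k::field fls"
  assumes "{n..} \<subseteq> H" "\<And>i. i < int n \<Longrightarrow> fls_nth f i = 0"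
  shows "f \<in> conductor H"
proof -
  have "f * fps_to_fls h \<in> semigroup_ring_set H" for h
    unfolding semigroup_ring_set_iff
  proof (intro allI impI)
    fix i assume "fls_nth (f * fps_to_fls h) i \<noteq> 0"
    then have "\<not> i < int n + 0"
      using fls_times_nth_eq_0[of "int n" f 0 "fps_to_fls h" i] assms(2) by auto
    with assms(1) show "i \<in> int ` H"
      by (intro image_eqI[of _ int "nat i"]) auto
  qed
  then show ?thesis by (auto simp: conductor_def)
qed

text \<open>The \<open>LEAST\<close> in the definition is meaningful only if a minimal generator
  exists; the least nonzero element of \<open>H\<close> is one.\<close>

lemma least_generator_in:
  assumes "numerical_semigroup H"
  shows "least_generator H \<in> H - {0}"
proof -
  have "infinite H"
    using assms infinite_UNIV_nat by (metis Compl_partition finite_UnI numerical_semigroup_def)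
  then obtain h where "h \<in> H - {0}"
    by (metis finite.emptyI finite_Diff_insert all_not_in_conv Diff_empty)
  then have m: "(LEAST h. h \<in> H - {0}) \<in> H - {0}" by (rule LeastI)
  have "(LEAST h. h \<in> H - {0}) \<in> minimal_generators H"
    unfolding minimal_generators_def
  proof (intro CollectI conjI notI)
    assume "\<exists>a\<in>H - {0}. \<exists>b\<in>H - {0}. (LEAST h. h \<in> H - {0}) = a + b"
    then obtain a b where ab: "a \<in> H - {0}" "b \<in> H - {0}" "(LEAST h. h \<in> H - {0}) = a + b"
      by blast
    have "(LEAST h. h \<in> H - {0}) \<le> a" using ab(1) by (rule Least_le)
    with ab show False by simp
  qed (use m in auto)
  then have "least_generator H \<in> minimal_generators H"
    unfolding least_generator_def by (rule LeastI)
  then show ?thesis by (simp add: minimal_generators_def)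
qed

lemma one_notin_numerical_semigroup:
  assumes "numerical_semigroup H" "H \<noteq> UNIV"
  shows "1 \<notin> H"
proof
  assume "1 \<in> H"
  then have "n \<in> H" for n
  proof (induction n)
    case (Suc n)
    then have "n + 1 \<in> H" using assms(1) \<open>1 \<in> H\<close> unfolding numerical_semigroup_def by blast
    then show ?case by simp
  qed (use assms(1) in \<open>simp add: numerical_semigroup_def\<close>)
  with assms(2) show False by auto
qed

lemma Frobenius_numberE:
  assumes "numerical_semigroup H" "H \<noteq> UNIV"
  obtains F where "F \<notin> H" "0 < F" "{Suc F..} \<subseteq> H"
proof -
  have fin: "finite (- H)" and ne: "- H \<noteq> {}"
    using assms by (auto simp: numerical_semigroup_def)
  have "Max (- H) \<notin> H" using Max_in[OF fin ne] by simp
  moreover have "0 < Max (- H)"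
    using calculation assms(1) by (metis gr0I numerical_semigroup_def)
  moreover have "{Suc (Max (- H))..} \<subseteq> H"
  proof
    fix n assume "n \<in> {Suc (Max (- H))..}"
    then have "n \<notin> - H" using Max_ge[OF fin, of n] by fastforce
    then show "n \<in> H" by simp
  qed
  ultimately show thesis by (rule that)
qed

section \<open>The reduced type when \<open>F\<close> and \<open>F - 1\<close> are gaps\<close>

lemma two_le_reduced_typeI:
  assumes H: "numerical_semigroup H" "H \<noteq> UNIV"
    and F: "F \<notin> H" "F - 1 \<notin> H" "0 < F" "{Suc F..} \<subseteq> H"
  shows "2 \<le> reduced_type TYPE('k::field) H"
proof -
  define b where "b = least_generator H"
  have "b \<in> H - {0}" unfolding b_def by (rule least_generator_in[OF H(1)])
  moreover have "b \<noteq> 1" using calculation one_notin_numerical_semigroup[OF H] by auto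
  \<comment> \<open>This makes even \<open>F - 1 + b\<close> exceed \<open>F\<close>, so both powers
    of t lie in the conductor.\<close>
  ultimately have b: "2 \<le> b" by auto
  define xS :: "'k fls set" where "xS = (\<lambda>f. fls_X ^ b * f) ` semigroup_ring_set H"
  have vanish: "fls_nth u (int (F + b)) = 0 \<and> fls_nth u (int (F - 1 + b)) = 0" if "u \<in> xS" for u
  proof -
    have nat: "fls_nth x (int n) = 0" if "x \<in> semigroup_ring_set H" "n \<notin> H" for x :: "'k fls" and n
      using that by (auto simp: semigroup_ring_set_iff)
    obtain x where x: "x \<in> semigroup_ring_set H" "u = fls_X ^ b * x"
      using \<open>u \<in> xS\<close> by (auto simp: xS_def)
    show ?thesis
      using nat[OF x(1) F(1)] nat[OF x(1) F(2)] F(3)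
      by (simp add: x(2) fls_X_power_times_conv_shift(1))
  qed
  have "(0::'k fls) \<in> xS"
    by (auto simp: xS_def semigroup_ring_set_iff intro: image_eqI[of _ _ 0])
  then have mem: "c \<in> {c + f | c f. c \<in> conductor H \<and> f \<in> xS}" if "c \<in> conductor H" for c
    using that by (intro CollectI exI[of _ c] exI[of _ 0]) simp
  have cond: "fls_X ^ n \<in> (conductor H :: 'k fls set)" if "F < n" for n
    by (rule in_conductor_if_high_order[OF F(4)]) (use that in auto)
  have "2 \<le> quotient_dim {c + f | c f. c \<in> conductor H \<and> f \<in> xS} xS"
  proof (rule two_le_quotient_dimI[OF vanish])
    show "fls_X ^ (F + b) \<in> {c + f | c f. c \<in> conductor H \<and> f \<in> xS}"
      "fls_X ^ (F - 1 + b) \<in> {c + f | c f. c \<in> conductor H \<and> f \<in> xS}"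
      using b F(3) by (intro mem cond; simp)+
  \<comment> \<open>Positivity of \<open>F\<close> keeps the two exponents distinct under truncated
    subtraction.\<close>
  qed (use F(3) in auto)
  then show ?thesis
    by (simp add: reduced_type_def Let_def xS_def b_def)
qed

section \<open>Fractional ideals of type one\<close>

lemma module_laurent_moduleD:
  fixes W :: "'k::field fls set"
  assumes "module (semigroup_ring H) (laurent_module W)"
  shows "0 \<in> W" "\<And>v w. v \<in> W \<Longrightarrow> w \<in> W \<Longrightarrow> v + w \<in> W"
    "\<And>r w. r \<in> semigroup_ring_set H \<Longrightarrow> w \<in> W \<Longrightarrow> r * w \<in> W"
    "\<And>q r :: 'k fls. q \<in> semigroup_ring_set H \<Longrightarrow> r \<in> semigroup_ring_set H \<Longrightarrow> q * r \<in> semigroup_ring_set H"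
proof -
  interpret M: module "semigroup_ring H" "laurent_module W" by (rule assms)
  show "0 \<in> W" using M.M.zero_closed by (simp add: laurent_module_def)
  show "v + w \<in> W" if "v \<in> W" "w \<in> W" for v w
    using M.M.add.m_closed[of v w] that by (simp add: laurent_module_def)
  show "r * w \<in> W" if "r \<in> semigroup_ring_set H" "w \<in> W" for r w
    using M.smult_closed[of r w] that by (simp add: laurent_module_def semigroup_ring_def)
  show "q * r \<in> semigroup_ring_set H"
    if "q \<in> semigroup_ring_set H" "r \<in> semigroup_ring_set H" for q r :: "'k fls"
    using M.R.m_closed[of q r] that by (simp add: semigroup_ring_def)
qed

text \<open>Multiplication by \<open>t\<^bsup>b\<^sub>1\<^esup>\<close> identifies \<open>(W : \<mm>) / W\<close> with the socle of \<open>W / t\<^bsup>b\<^sub>1\<^esup> W\<close>.\<close>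

lemma cm_type_eq_1E:
  fixes W :: "'k::field fls set"
  assumes H: "numerical_semigroup H" and W: "fls.subspace W" and type: "cm_type H W = 1"
  obtains s where "s \<notin> W"
    "\<And>y. (\<And>r. r \<in> maximal_ideal H \<Longrightarrow> r * y \<in> W) \<Longrightarrow> \<exists>c. y - fls_const c * s \<in> W"
proof -
  define x :: "'k fls" where "x = fls_X ^ least_generator H"
  have x0: "x \<noteq> 0" by (simp add: x_def)
  have x: "x \<in> maximal_ideal H"
    using least_generator_in[OF H]
    by (auto simp: maximal_ideal_def x_def fls_X_power_in_semigroup_ring)
  have xW_iff: "f \<in> (*) x ` W \<longleftrightarrow> f / x \<in> W" for f
    using x0 by (auto simp: field_simps intro!: image_eqI[of _ _ "f / x"])
  have sub: "fls.subspace ((*) x ` W)"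
  proof (rule fls.subspaceI)
    fix f g c assume "f \<in> (*) x ` W" "g \<in> (*) x ` W"
    then show "f + g \<in> (*) x ` W" 
      using fls.subspace_add[OF W, of "f / x" "g / x"] by (simp add: xW_iff add_divide_distrib)
  next
    fix c f assume "f \<in> (*) x ` W"
    then show "fls_const c * f \<in> (*) x ` W"
      using fls.subspace_scale[OF W, of "f / x" c] by (simp add: xW_iff)
  qed (use fls.subspace_0[OF W] xW_iff in simp)
  have "quotient_dim {w \<in> W. \<forall>r \<in> maximal_ideal H. r * w \<in> (*) x ` W} ((*) x ` W) = 1"
    using type by (simp add: cm_type_def Let_def x_def)
  then obtain b where b: "b \<notin> (*) x ` W"
    "\<And>v. v \<in> W \<Longrightarrow> (\<forall>r \<in> maximal_ideal H. r * v \<in> (*) x ` W) \<Longrightarrow> \<exists>c. v - fls_const c * b \<in> (*) x ` W"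
    using sub by (rule quotient_dim_eq_1E) blast
  show thesis
  proof (rule that)
    show "b / x \<notin> W" using b(1) by (simp add: xW_iff)
    fix y assume y: "\<And>r. r \<in> maximal_ideal H \<Longrightarrow> r * y \<in> W"
    have "\<forall>r \<in> maximal_ideal H. r * (x * y) \<in> (*) x ` W"
      using y x0 by (simp add: xW_iff)
    with b(2)[OF y[OF x]] obtain c where "x * y - fls_const c * b \<in> (*) x ` W" by blast
    then show "\<exists>c. y - fls_const c * (b / x) \<in> W"
      using x0 by (auto simp: xW_iff diff_divide_distrib)
  qed
qed

text \<open>If \<open>H\<close> contains everything from n on, every series of order at least n lies
  in S, and its multiples by \<open>w\<close> lie in \<open>W\<close>; these are all series of order
  at least n plus the order of \<open>w\<close>.\<close>

lemma fractional_ideal_contains_high_order: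
  fixes W :: "'k::field fls set"
  assumes H: "numerical_semigroup H" and W: "module (semigroup_ring H) (laurent_module W)"
    and w: "w \<in> W" "w \<noteq> 0"
  obtains N :: int where "\<And>f. (\<And>k. k < N \<Longrightarrow> fls_nth f k = 0) \<Longrightarrow> f \<in> W"
proof -
  obtain n where n: "{n..} \<subseteq> H"
  proof -
    have "\<exists>n. \<forall>k \<in> - H. k < n"
      using H finite_nat_set_iff_bounded[of "- H"] by (simp add: numerical_semigroup_def)
    then show thesis using that by (metis ComplI atLeast_iff not_less subsetI)
  qed
  show thesis
  proof (rule that)
    fix f :: "'k fls" assume f: "\<And>k. k < int n + fls_subdegree w \<Longrightarrow> fls_nth f k = 0"
    have "f / w \<in> conductor H"
    proof (rule in_conductor_if_high_order[OF n])
      fix i assume "i < int n"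
      moreover have "fls_nth (inverse w) k = 0" if "k < - fls_subdegree w" for k
        by (rule fls_eq0_below_subdegree) (use that w in \<open>simp add: fls_inverse_subdegree\<close>)
      ultimately show "fls_nth (f / w) i = 0"
        using fls_times_nth_eq_0[of "int n + fls_subdegree w" f "- fls_subdegree w" "inverse w" i] f
        by (simp add: field_class.field_divide_inverse)
    qed
    then have "f / w * fps_to_fls 1 \<in> semigroup_ring_set H"
      unfolding conductor_def by blast
    then show "f \<in> W"
      using module_laurent_moduleD(3)[OF W _ w(1), of "f / w"] w(2) by simp
  qed
qed

text \<open>The second and third conclusions say \<open>W = g\<^sup>-\<^sup>1 K\<close>, with \<open>K\<close> the standard canonical ideal
  consisting of the series without terms \<open>t\<^bsup>-h\<^esup>\<close>, \<open>h \<in> H\<close>.\<close>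

lemma type_one_fractional_ideal:
  fixes W :: "'k::field fls set"
  assumes H: "numerical_semigroup H" and W: "module (semigroup_ring H) (laurent_module W)"
    and ne: "W \<noteq> {0}" and type: "cm_type H W = 1"
  obtains g where "g \<noteq> 0"
    "\<And>w h. w \<in> W \<Longrightarrow> h \<in> H \<Longrightarrow> fls_nth (g * w) (- int h) = 0"
    "\<And>y. (\<And>r. r \<in> semigroup_ring_set H \<Longrightarrow> fls_nth (g * (r * y)) 0 = 0) \<Longrightarrow> y \<in> W"
proof -
  note M = module_laurent_moduleD[OF W]
  have H0: "0 \<in> H" using H by (simp add: numerical_semigroup_def)
  have sub: "fls.subspace W"
    using M(1,2) M(3)[OF fls_const_in_semigroup_ring[OF H0]] by (intro fls.subspaceI)
  obtain s where s: "s \<notin> W"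
    "\<And>y. (\<And>r. r \<in> maximal_ideal H \<Longrightarrow> r * y \<in> W) \<Longrightarrow> \<exists>c. y - fls_const c * s \<in> W"
    using cm_type_eq_1E[OF H sub type] by metis
  obtain \<phi> where \<phi>: "\<And>f g. \<phi> (f + g) = \<phi> f + \<phi> g" "\<And>c f. \<phi> (fls_const c * f) = c * \<phi> f"
    "\<And>w. w \<in> W \<Longrightarrow> \<phi> w = 0" "\<phi> s = 1"
    using functional_separating_subspace[OF sub s(1)] by metis
  obtain w where "w \<in> W" "w \<noteq> 0" using ne M(1) by auto
  then obtain N where N: "\<And>f. (\<And>k. k < N \<Longrightarrow> fls_nth f k = 0) \<Longrightarrow> f \<in> W"
    using fractional_ideal_contains_high_order[OF H W] by metis
  obtain g where g: "\<And>f. \<phi> f = fls_nth (g * f) 0"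
    using continuous_functional_representation[OF \<phi>(1,2), of N] \<phi>(3) N by metis
  \<comment> \<open>Induction on how far below \<open>N\<close> the series \<open>y\<close> may
    start. Elements of the maximal ideal raise the order, so they carry \<open>y\<close> into
    \<open>W\<close>; hence \<open>y\<close> is congruent to a multiple of \<open>s\<close>, and
    since \<open>\<phi>\<close> kills \<open>y\<close> the factor is 0.\<close>
  have in_W: "y \<in> W" if "\<And>r. r \<in> semigroup_ring_set H \<Longrightarrow> \<phi> (r * y) = 0"
    "\<And>k. k < N - int n \<Longrightarrow> fls_nth y k = 0" for y n
    using that
  proof (induction n arbitrary: y)
    case 0
    then show ?case by (intro N) simp
  next
    case (Suc n)
    have "r * y \<in> W" if r: "r \<in> maximal_ideal H" for r
    proof (rule Suc.IH)
      have rS: "r \<in> semigroup_ring_set H" and r0: "fls_nth r 0 = 0"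
        using r by (auto simp: maximal_ideal_def)
      show "\<phi> (q * (r * y)) = 0" if "q \<in> semigroup_ring_set H" for q
        using Suc.prems(1)[OF M(4)[OF that rS]] by (simp only: mult.assoc)
      have "fls_nth r i = 0" if "i < 1" for i
      proof (rule ccontr)
        assume "fls_nth r i \<noteq> 0"
        then have "0 \<le> i" using rS by (auto simp: semigroup_ring_set_iff)
        with that \<open>fls_nth r i \<noteq> 0\<close> r0 show False by (cases "i = 0") auto
      qed
      then show "fls_nth (r * y) k = 0" if "k < N - int n" for k
        by (rule fls_times_nth_eq_0[OF _ Suc.prems(2)]) (use that in auto)
    qed
    from s(2)[OF this] obtain c where c: "y - fls_const c * s \<in> W" by blast
    have "\<phi> y = \<phi> (y - fls_const c * s) + \<phi> (fls_const c * s)"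
      using \<phi>(1)[of "y - fls_const c * s" "fls_const c * s"] by simp
    moreover have "\<phi> y = 0"
      using Suc.prems(1)[OF fls_const_in_semigroup_ring[OF H0, of 1]] by simp
    ultimately have "c = 0" using \<phi> c by simp
    with c show ?case by simp
  qed
  show thesis
  proof (rule that)
    show "g \<noteq> 0" using g[of s] \<phi>(4) by auto
    show "fls_nth (g * w) (- int h) = 0" if "w \<in> W" "h \<in> H" for w h
    proof -
      \<comment> \<open>Multiplying by the power h of t moves the coefficient at -h to the constant
        term.\<close>
      have "\<phi> (fls_X ^ h * w) = 0"
        by (intro \<phi>(3) M(3) fls_X_power_in_semigroup_ring that)
      moreover have "g * (fls_X ^ h * w) = fls_X ^ h * (g * w)"
        by (rule mult.left_commute)
      ultimately have "fls_nth (fls_X ^ h * (g * w)) 0 = 0"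
        by (simp only: g)
      then show ?thesis
        by (simp only: fls_X_power_times_conv_shift(1) fls_shift_nth) simp
    qed
    show "y \<in> W" if y: "\<And>r. r \<in> semigroup_ring_set H \<Longrightarrow> fls_nth (g * (r * y)) 0 = 0" for y
    proof (rule in_W)
      show "\<phi> (r * y) = 0" if "r \<in> semigroup_ring_set H" for r
        unfolding g using that by (rule y)
      show "fls_nth y k = 0" if "k < N - int (nat (N - fls_subdegree y))" for k
        by (rule fls_eq0_below_subdegree) (use that in linarith)
    qed
  qed
qed

section \<open>The trace ideal and the gap below \<open>F\<close>\<close>

lemma mult_in_trace_ideal:
  assumes "\<And>w. w \<in> W \<Longrightarrow> f * w \<in> semigroup_ring_set H" "w \<in> W"
  shows "f * w \<in> trace_ideal H W"
proof -
  have "(\<lambda>w. f * w) \<in> module_hom (semigroup_ring H) (laurent_module W)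
      (laurent_module (semigroup_ring_set H))"
    using assms(1)
    by (simp add: module_hom_def laurent_module_def distrib_left mult.left_commute)
  then have "f * w \<in> (\<Union>f \<in> module_hom (semigroup_ring H) (laurent_module W)
      (laurent_module (semigroup_ring_set H)). f ` W)"
    by (rule UN_I) (rule imageI[OF assms(2)])
  then show ?thesis
    unfolding trace_ideal_def genideal_def by (intro InterI) (auto simp only: mem_Collect_eq)
qed

lemma far_flung_Gorenstein_gap:
  assumes H: "numerical_semigroup H" "far_flung_Gorenstein TYPE('k::field) H"
    and F: "F \<notin> H" "0 < F" "{Suc F..} \<subseteq> H"
  shows "F - 1 \<notin> H"
proof
  assume F1: "F - 1 \<in> H"
  obtain W :: "'k fls set" where W: "canonical_module H W" "trace_ideal H W = conductor H"
    using H(2) by (auto simp: far_flung_Gorenstein_def)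
  obtain g where g: "g \<noteq> 0"
    "\<And>w h. w \<in> W \<Longrightarrow> h \<in> H \<Longrightarrow> fls_nth (g * w) (- int h) = 0"
    "\<And>y. (\<And>r. r \<in> semigroup_ring_set H \<Longrightarrow> fls_nth (g * (r * y)) 0 = 0) \<Longrightarrow> y \<in> W"
    using W(1) unfolding canonical_module_def by (metis type_one_fractional_ideal[OF H(1)])
  define w where "w = inverse g * fls_X_intpow (- int F)"
  \<comment> \<open>The exponent is chosen so that \<open>f * w\<close> becomes t to the power
    \<open>F - 1\<close>.\<close>
  define f where "f = fls_X_intpow (2 * int F - 1) * g"
  have "w \<in> W"
  proof (rule g(3))
    fix r :: "'k fls" assume r: "r \<in> semigroup_ring_set H"
    have "g * (r * w) = r * fls_X_intpow (- int F)"
      using g(1) by (simp add: w_def)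
    moreover have "fls_nth r (int F) = 0"
      using r F(1) by (auto simp: semigroup_ring_set_iff)
    ultimately show "fls_nth (g * (r * w)) 0 = 0"
      by (simp only: fls_X_intpow_times_conv_shift(2) fls_shift_nth) simp
  qed
  moreover have "f * v \<in> semigroup_ring_set H" if v: "v \<in> W" for v
    unfolding semigroup_ring_set_iff
  proof (intro allI impI)
    fix n assume "fls_nth (f * v) n \<noteq> 0"
    moreover have "f * v = fls_shift (- (2 * int F - 1)) (g * v)"
      unfolding f_def mult.assoc by (rule fls_X_intpow_times_conv_shift(1))
    ultimately have nz: "fls_nth (g * v) (n - (2 * int F - 1)) \<noteq> 0"
      by (simp add: algebra_simps)
    \<comment> \<open>The term of \<open>g * v\<close> in question has exponent -l, so l is not in
      \<open>H\<close>. Since l is at most \<open>F\<close> and differs from \<open>F - 1\<close>,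
      either l = F and n = F - 1, or l <= F - 2 and n > F.\<close>
    define l where "l = 2 * int F - 1 - n"
    have "n - (2 * int F - 1) = - l"
      by (simp add: l_def)
    with nz have l: "l \<notin> int ` H"
      using g(2)[OF v] by auto
    have "l \<le> int F"
    proof (rule ccontr)
      assume "\<not> l \<le> int F"
      then have "nat l \<in> H" "l = int (nat l)" using F(3) by auto
      with l show False by blast
    qed
    moreover have "l \<noteq> int F - 1"
      using l F1 F(2) by (auto simp: image_iff of_nat_diff)
    ultimately have "n = int (F - 1) \<or> int F < n"
      using F(2) by (auto simp: l_def of_nat_diff)
    then show "n \<in> int ` H"
      using F1 F(3) by (auto intro!: image_eqI[of _ int "nat n"])
  qed
  ultimately have "f * w \<in> conductor H"
    using mult_in_trace_ideal W(2) by blast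
  moreover have "f * w = fls_X_intpow (int F - 1)"
  proof -
    have "f * w = (g * inverse g) * (fls_X_intpow (2 * int F - 1) * fls_X_intpow (- int F))"
      by (simp only: f_def w_def mult_ac)
    with g(1) show ?thesis
      by (simp only: fls_X_intpow_times_fls_X_intpow right_inverse) simp
  qed
  \<comment> \<open>Multiplying this conductor element by t would put the power \<open>F\<close> of
    t into S.\<close>
  ultimately have "fls_X_intpow (int F - 1) * fps_to_fls fps_X \<in> (semigroup_ring_set H :: 'k fls set)"
    unfolding conductor_def by (metis (mono_tags, lifting) mem_Collect_eq rangeI)
  then have "fls_nth (fls_X_intpow (int F - 1) * fps_to_fls fps_X :: 'k fls) (int F) \<noteq> 0 \<longrightarrow> int F \<in> int ` H"
    unfolding semigroup_ring_set_iff by blast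
  then have "int F \<in> int ` H"
    unfolding fls_X_intpow_times_conv_shift(1) by simp
  with F(1) show False by auto
qed

theorem proposition3p22:
  fixes H :: "nat set"
  assumes "numerical_semigroup H" and "H \<noteq> UNIV"
    and "far_flung_Gorenstein TYPE('k::{alg_closed_field, field_char_0}) H"
  shows "reduced_type TYPE('k) H \<ge> 2"
proof -
  obtain F where F: "F \<notin> H" "0 < F" "{Suc F..} \<subseteq> H"
    using Frobenius_numberE[OF assms(1,2)] .
  show ?thesis
    by (rule two_le_reduced_typeI[OF assms(1,2) F(1) far_flung_Gorenstein_gap[OF assms(1,3) F] F(2,3)])
qed

end
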